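(* Let $$A(x,y)=A(x,y;p,q,r)=\sum_{\pi\in\mathcal{F}}x^{|\pi|}y^{\mathrm{trun}(\pi)-1}p^{\mathrm{asc}(\pi)}q^{\mathrm{des}(\pi)}r^{\mathrm{lev}(\pi)}$$ be the generating function that enumerates the members of $\mathcal{F}$ jointly according to length, $\mathrm{trun}-1$, $\mathrm{asc}$, $\mathrm{des}$ and $\mathrm{lev}$ (marked by $x$, $y$, $p$, $q$ and $r$, respectively). Then $$A(x,y)=\frac{x(1-(p+r)x)^2}{(1-(r+py)x)\left(1-2(p+r)x+((p+r)^2-pq)x^2\right)}.$$
   Context: A Catalan word of length $n\geq 1$ is an integer sequence $\pi=\pi_1\cdots\pi_n$ with $\pi_1=1$ and $1\leq \pi_{i+1}\leq \pi_i+1$ for $1\leq i\leq n-1$. A (weakly) increasing run of a word is a maximal nondecreasing string of consecutive letters. A Catalan word is flattened if the sequence of first letters of its increasing runs, read from left to right, is nondecreasing. $\mathcal{F}_n$ is the set of flattened Catalan words of length $n$, $\mathcal{F}=\cup_{n\geq 1}\mathcal{F}_n$, and $|\pi|$ is the length of $\pi$. For a word $w$, $\mathrm{trun}(w)$ is the number of distinct letters appearing in the rightmost increasing run of $w$. For $w=w_1\cdots w_n$, $\mathrm{asc}(w)$, $\mathrm{des}(w)$, $\mathrm{lev}(w)$ denote the numbers of indices $i\in\{1,\ldots,n-1\}$ with $w_i<w_{i+1}$, $w_i>w_{i+1}$, $w_i=w_{i+1}$, respectively. Here $x,y,p,q,r$ are indeterminates and generating functions are formal power series in $x$ with coefficients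 polynomial in $y,p,q,r$. *)

theory Defs
  imports "HOL-Computational_Algebra.Formal_Power_Series" "HOL-Computational_Algebra.Polynomial"
begin

text \<open>Words are 0-indexed integer lists, so \<open>w ! i\<close> is the letter with index \<open>i + 1\<close>
  in the usual notation.\<close>

definition catalan_word :: "int list \<Rightarrow> bool" where
  "catalan_word w \<longleftrightarrow> w \<noteq> [] \<and> w ! 0 = 1 \<and>
     (\<forall>i. Suc i < length w \<longrightarrow> 1 \<le> w ! Suc i \<and> w ! Suc i \<le> w ! i + 1)"

fun runs :: "int list \<Rightarrow> int list list" where
  "runs [] = []"
| "runs [a] = [[a]]"
| "runs (a # b # w) =
     (if a \<le> b then (a # hd (runs (b # w))) # tl (runs (b # w))
      else [a] # runs (b # w))"

text \<open>The following lemmas say that \<open>runs w\<close> is the list, from left to right, of the maximal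
  nondecreasing strings of consecutive letters of \<open>w\<close>.\<close>

lemma runs_nonempty: "w \<noteq> [] \<Longrightarrow> runs w \<noteq> []"
  by (induction w rule: runs.induct) auto

lemma concat_runs: "concat (runs w) = w"
proof (induction w rule: runs.induct)
  case (3 a b w)
  then show ?case
    using runs_nonempty[of "b # w"] by (cases "runs (b # w)") auto
qed auto

lemma runs_sorted:
  "(\<forall>u \<in> set (runs w). u \<noteq> [] \<and> sorted u) \<and> (w \<noteq> [] \<longrightarrow> hd (hd (runs w)) = hd w)"
proof (induction w rule: runs.induct)
  case (3 a b w)
  obtain u us where *: "runs (b # w) = u # us"
    using runs_nonempty[of "b # w"] by (cases "runs (b # w)") auto
  have "(\<forall>v \<in> set (runs (b # w)). v \<noteq> [] \<and> sorted v) \<and> hd (hd (runs (b # w))) = b"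
    using 3 by (cases "a \<le> b") auto
  with * obtain u' where "u = b # u'" "sorted u" "\<forall>v \<in> set us. v \<noteq> [] \<and> sorted v"
    by (cases u) auto
  with * show ?case
    by auto
qed auto

lemma runs_maximal:
  "successively (\<lambda>u v. last u > hd v) (runs w)"
proof (induction w rule: runs.induct)
  case (3 a b w)
  obtain u us where *: "runs (b # w) = u # us"
    using runs_nonempty[of "b # w"] by (cases "runs (b # w)") auto
  have "u \<noteq> []" "hd u = b"
    using runs_sorted[of "b # w"] * by auto
  with 3 * show ?case
    by (cases us) (auto split: if_splits)
qed auto

definition flattened :: "int list \<Rightarrow> bool" where
  "flattened w \<longleftrightarrow> sorted (map hd (runs w))"

definition flattened_catalan :: "nat \<Rightarrow> int list set" where
  "flattened_catalan n = {w. length w = n \<and> catalan_word w \<and> flattened w}"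

lemma catalan_word_bounds:
  assumes "catalan_word w" "i < length w"
  shows "1 \<le> w ! i \<and> w ! i \<le> int i + 1"
  using assms(2)
proof (induction i)
  case 0
  then show ?case using assms(1) by (simp add: catalan_word_def)
next
  case (Suc i)
  then have "1 \<le> w ! Suc i" "w ! Suc i \<le> w ! i + 1"
    using assms(1) by (auto simp: catalan_word_def)
  with Suc show ?case by simp
qed

lemma finite_flattened_catalan: "finite (flattened_catalan n)"
proof (rule finite_subset)
  show "flattened_catalan n \<subseteq> {w. set w \<subseteq> {1..int n} \<and> length w = n}"
  proof
    fix w assume w: "w \<in> flattened_catalan n"
    have "set w \<subseteq> {1..int n}"
    proof
      fix a assume "a \<in> set w"
      then obtain i where "i < length w" "a = w ! i"
        by (auto simp: in_set_conv_nth)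
      with catalan_word_bounds[of w i] w show "a \<in> {1..int n}"
        by (auto simp: flattened_catalan_def)
    qed
    with w show "w \<in> {w. set w \<subseteq> {1..int n} \<and> length w = n}"
      by (simp add: flattened_catalan_def)
  qed
  show "finite {w. set w \<subseteq> {1..int n} \<and> length w = n}"
    by (rule finite_lists_length_eq) simp
qed

definition trun :: "int list \<Rightarrow> nat" where
  "trun w = card (set (last (runs w)))"

definition asc :: "int list \<Rightarrow> nat" where
  "asc w = card {i. Suc i < length w \<and> w ! i < w ! Suc i}"

definition des :: "int list \<Rightarrow> nat" where
  "des w = card {i. Suc i < length w \<and> w ! i > w ! Suc i}"

definition lev :: "int list \<Rightarrow> nat" where
  "lev w = card {i. Suc i < length w \<and> w ! i = w ! Suc i}"

text \<open>The polynomial ring in the indeterminates \<open>y\<close>, \<open>p\<close>, \<open>q\<close>, \<open>r\<close> over the integers, as the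
  iterated polynomial ring with \<open>y\<close> innermost and \<open>r\<close> outermost.\<close>

type_synonym coeff_ring = "int poly poly poly poly"

definition y_var :: coeff_ring where "y_var = [:[:[:[:0, 1:]:]:]:]"
definition p_var :: coeff_ring where "p_var = [:[:[:0, 1:]:]:]"
definition q_var :: coeff_ring where "q_var = [:[:0, 1:]:]"
definition r_var :: coeff_ring where "r_var = [:0, 1:]"

text \<open>The truncated subtraction is harmless: \<open>trun w \<ge> 1\<close> for every nonempty word. The empty
  word is not Catalan, so the series has no constant term.\<close>

definition A_gf :: "coeff_ring fps" where
  "A_gf = Abs_fps (\<lambda>n. \<Sum>w\<in>flattened_catalan n.
     y_var ^ (trun w - 1) * p_var ^ asc w * q_var ^ des w * r_var ^ lev w)"

text \<open>The library's division of power series needs a division on coefficients, which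
  \<open>coeff_ring\<close> lacks. A series with constant term \<open>1\<close> is nevertheless a unit, and
  \<open>fps_right_inverse g 1\<close> is its inverse.\<close>

definition fps_quot :: "'a::comm_ring_1 fps \<Rightarrow> 'a fps \<Rightarrow> 'a fps" where
  "fps_quot f g = f * fps_right_inverse g 1"

lemma fps_quot_iff:
  assumes "fps_nth g 0 = 1"
  shows "h = fps_quot f g \<longleftrightarrow> h * g = f"
proof -
  define i where "i = fps_right_inverse g 1"
  have gi: "g * i = 1"
    unfolding i_def using assms by (intro fps_right_inverse) simp
  have "f * i * g = f"
    using gi by (simp add: mult.assoc mult.commute[of i g])
  moreover have "h * g * i = h"
    using gi by (simp add: mult.assoc)
  ultimately show ?thesis
    unfolding fps_quot_def i_def by auto
qed

end

theory Submission
  imports Defs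
begin

text \<open>A flattened Catalan word is best grown one letter at a time at its right end, and the only
  thing one has to remember while doing so is \<open>t = trun w - 1\<close>. Inside an increasing run of a
  Catalan word the letters rise by steps of at most one, so a last run that starts with \<open>h\<close> and
  ends with \<open>l\<close> contains every letter from \<open>h\<close> to \<open>l\<close>, and \<open>t = l - h\<close>. The letters \<open>c\<close> that may
  follow are those with \<open>h \<le> c \<le> l + 1\<close>: the upper bound is the Catalan condition, while the lower
  bound says that \<open>c\<close>, should it open a new run, does not start it below \<open>h\<close>, the largest of the
  earlier first letters. Hence \<open>t\<close> evolves as follows:

  \<^item> \<open>c = l + 1\<close> is an ascent and turns \<open>t\<close> into \<open>t + 1\<close>;
  \<^item> \<open>c = l\<close> is a level and keeps \<open>t\<close>;
  \<^item> each of the \<open>l - h = t\<close> letters \<open>c\<close> with \<open>h \<le> c < l\<close> is a descent and resets \<open>t\<close> to \<open>0\<close>.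

  For an arbitrary function \<open>f\<close> let \<open>G f\<close> be the series in which a word \<open>w\<close> has weight
  \<open>f (trun w - 1)\<close> times the usual monomial in \<open>p\<close>, \<open>q\<close>, \<open>r\<close>. The three cases give
  \<open>G f = x (f 0 + G f')\<close> with \<open>f' t = p f (t + 1) + r f t + q t f 0\<close>
  (lemma \<open>trun_gf_recurrence\<close>). Writing \<open>A\<close>, \<open>B\<close>, \<open>D\<close> for \<open>G f\<close> with \<open>f t = y\<^sup>t\<close>, \<open>f t = 1\<close>, \<open>f t = t\<close>,
  and \<open>s = p + r\<close>, this is the linear system
  \[ (1 - (r + py) x) A = x + q x D, \quad (1 - s x) B = x + q x D, \quad (1 - s x) D = p x B. \]
  The last two equations give \<open>((1 - s x)\<^sup>2 - p q x\<^sup>2) D = p x\<^sup>2\<close>, and the first one then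
  yields \<open>A\<close>. The quadratic factor on the left is the one in the theorem. The series \<open>B\<close> and \<open>D\<close>
  are the value at \<open>y = 1\<close> of \<open>A\<close> and of its derivative with respect to \<open>y\<close>.\<close>

section \<open>Appending a letter to a word\<close>

lemma runs_snoc:
  assumes "w \<noteq> []"
  shows "runs (w @ [c]) =
    (if last w \<le> c then butlast (runs w) @ [last (runs w) @ [c]] else runs w @ [[c]])"
  using assms
proof (induction w rule: runs.induct)
  case (3 a b w)
  obtain u us where *: "runs (b # w) = u # us"
    using runs_nonempty[of "b # w"] by (cases "runs (b # w)") auto
  with 3 show ?case
    by (cases "us = []") (auto split: if_splits)
qed auto

lemma last_runs:
  assumes "w \<noteq> []"
  shows "last (runs w) \<noteq> []" "sorted (last (runs w))" "last (last (runs w)) = last w"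
proof -
  have "last (runs w) \<in> set (runs w)"
    using runs_nonempty[OF assms] by simp
  then show ne: "last (runs w) \<noteq> []" and "sorted (last (runs w))"
    using runs_sorted[of w] by auto
  have "w = concat (butlast (runs w)) @ last (runs w)"
    using concat_runs[of w] runs_nonempty[OF assms]
    by (metis append_butlast_last_id concat.simps concat_append append_Nil2)
  with ne show "last (last (runs w)) = last w"
    by (metis last_appendR)
qed

definition last_run_start :: "int list \<Rightarrow> int" where
  "last_run_start w = hd (last (runs w))"

lemma last_run_start_snoc:
  assumes "w \<noteq> []"
  shows "last_run_start (w @ [c]) = (if last w \<le> c then last_run_start w else c)"
  using assms by (simp add: last_run_start_def runs_snoc last_runs)

lemma last_run_start_le_last:
  assumes "w \<noteq> []"
  shows "last_run_start w \<le> last w"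
proof -
  obtain a u where "last (runs w) = a # u"
    using last_runs(1)[OF assms] by (cases "last (runs w)") auto
  moreover have "last w \<in> set (last (runs w))"
    using last_runs(1,3)[OF assms] last_in_set by metis
  ultimately show ?thesis
    using last_runs(2)[OF assms] by (auto simp: last_run_start_def)
qed

text \<open>The first letters of the runs of a flattened word are nondecreasing, so a new one only has
  to be compared with the latest. If \<open>c\<close> prolongs the last run instead, the inequality on the
  right holds anyway.\<close>

lemma flattened_snoc:
  assumes "w \<noteq> []"
  shows "flattened (w @ [c]) \<longleftrightarrow> flattened w \<and> last_run_start w \<le> c"
proof -
  define us u where "us = butlast (runs w)" and "u = last (runs w)"
  have runs: "runs w = us @ [u]"
    using runs_nonempty[OF assms] by (simp add: us_def u_def)
  have "u \<noteq> []"
    using last_runs(1)[OF assms] by (simp add: u_def)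
  show ?thesis
  proof (cases "last w \<le> c")
    case True
    with last_run_start_le_last[OF assms] \<open>u \<noteq> []\<close> show ?thesis
      by (simp add: flattened_def runs_snoc[OF assms] runs)
  next
    case False
    then show ?thesis
      by (fastforce simp: flattened_def last_run_start_def runs_snoc[OF assms] runs sorted_append)
  qed
qed

lemma catalan_word_snoc:
  assumes "w \<noteq> []"
  shows "catalan_word (w @ [c]) \<longleftrightarrow> catalan_word w \<and> 1 \<le> c \<and> c \<le> last w + 1"
proof -
  define m where "m = length w - 1"
  have m: "length w = Suc m" using assms by (simp add: m_def)
  have "last w = w ! m" using assms by (simp add: last_conv_nth m_def)
  then show ?thesis
    using assms m by (auto simp: catalan_word_def nth_append less_Suc_eq all_conj_distrib)
qed

lemma last_run_start_ge_1:
  assumes "catalan_word w"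
  shows "1 \<le> last_run_start w"
proof -
  have w: "w \<noteq> []" using assms by (simp add: catalan_word_def)
  then have "last (runs w) \<in> set (runs w)"
    using runs_nonempty by simp
  with last_runs(1)[OF w] have "last_run_start w \<in> set (concat (runs w))"
    by (auto simp: last_run_start_def intro!: bexI[of _ "last (runs w)"])
  then obtain i where "i < length w" "last_run_start w = w ! i"
    by (auto simp: concat_runs in_set_conv_nth)
  with catalan_word_bounds[OF assms] show ?thesis by auto
qed

lemma flattened_catalan_snoc:
  assumes "w \<noteq> []"
  shows "w @ [c] \<in> flattened_catalan (Suc n) \<longleftrightarrow>
    w \<in> flattened_catalan n \<and> last_run_start w \<le> c \<and> c \<le> last w + 1"
  using last_run_start_ge_1[of w] assms
  by (auto simp: flattened_catalan_def catalan_word_snoc flattened_snoc)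

text \<open>Successive letters of a Catalan word rise by at most one, so its last run skips no letter.\<close>

lemma set_last_run:
  assumes "catalan_word w"
  shows "set (last (runs w)) = {last_run_start w..last w}"
  using assms
proof (induction w rule: rev_induct)
  case Nil
  then show ?case by (simp add: catalan_word_def)
next
  case (snoc c w)
  show ?case
  proof (cases "w = []")
    case True
    then show ?thesis by (simp add: last_run_start_def)
  next
    case False
    with snoc have IH: "set (last (runs w)) = {last_run_start w..last w}"
      and c: "c \<le> last w + 1"
      by (auto simp: catalan_word_snoc)
    have "last_run_start w \<le> last w"
      using False by (rule last_run_start_le_last)
    with IH c False show ?thesis
      by (auto simp: runs_snoc last_run_start_snoc)
  qed
qed

lemma trun_eq:
  assumes "catalan_word w"
  shows "trun w = Suc (nat (last w - last_run_start w))"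
proof -
  have "last_run_start w \<le> last w"
    using assms by (intro last_run_start_le_last) (auto simp: catalan_word_def)
  then show ?thesis
    unfolding trun_def set_last_run[OF assms] by simp
qed

text \<open>Common to \<open>asc\<close>, \<open>des\<close> and \<open>lev\<close>, which count the adjacent pairs in one of the relations
  \<open><\<close>, \<open>>\<close>, \<open>=\<close>.\<close>

lemma card_adjacent_snoc:
  assumes "w \<noteq> []"
  shows "card {i. Suc i < length (w @ [c]) \<and> R ((w @ [c]) ! i) ((w @ [c]) ! Suc i)} =
    card {i. Suc i < length w \<and> R (w ! i) (w ! Suc i)} + (if R (last w) c then 1 else 0)"
proof -
  define m where "m = length w - 1"
  have m: "length w = Suc m" using assms by (simp add: m_def)
  have l: "last w = w ! m" using assms by (simp add: last_conv_nth m_def)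
  have fin: "finite {i. Suc i < length w \<and> R (w ! i) (w ! Suc i)}"
    by (rule finite_subset[of _ "{..<length w}"]) auto
  have "{i. Suc i < length (w @ [c]) \<and> R ((w @ [c]) ! i) ((w @ [c]) ! Suc i)} =
      {i. Suc i < length w \<and> R (w ! i) (w ! Suc i)} \<union> (if R (last w) c then {m} else {})"
    using m l by (auto simp: nth_append less_Suc_eq split: if_splits)
  with fin m show ?thesis by auto
qed

lemma asc_snoc: "w \<noteq> [] \<Longrightarrow> asc (w @ [c]) = asc w + (if last w < c then 1 else 0)"
  unfolding asc_def by (rule card_adjacent_snoc)

lemma des_snoc: "w \<noteq> [] \<Longrightarrow> des (w @ [c]) = des w + (if last w > c then 1 else 0)"
  unfolding des_def by (rule card_adjacent_snoc)

lemma lev_snoc: "w \<noteq> [] \<Longrightarrow> lev (w @ [c]) = lev w + (if last w = c then 1 else 0)"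
  unfolding lev_def by (rule card_adjacent_snoc)

section \<open>The recurrence for generating functions\<close>

definition trun_weight :: "'a::comm_ring_1 \<Rightarrow> 'a \<Rightarrow> 'a \<Rightarrow> (nat \<Rightarrow> 'a) \<Rightarrow> int list \<Rightarrow> 'a" where
  "trun_weight p q r f w = f (trun w - 1) * p ^ asc w * q ^ des w * r ^ lev w"

definition trun_gf :: "'a::comm_ring_1 \<Rightarrow> 'a \<Rightarrow> 'a \<Rightarrow> (nat \<Rightarrow> 'a) \<Rightarrow> 'a fps" where
  "trun_gf p q r f = Abs_fps (\<lambda>n. \<Sum>w\<in>flattened_catalan n. trun_weight p q r f w)"

text \<open>One letter of growth, seen from the weights: instead of moving a word from \<open>t\<close> to its
  successors, the function \<open>f\<close> is pulled back along the three kinds of transition.\<close>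

definition trun_step :: "'a::comm_ring_1 \<Rightarrow> 'a \<Rightarrow> 'a \<Rightarrow> (nat \<Rightarrow> 'a) \<Rightarrow> nat \<Rightarrow> 'a" where
  "trun_step p q r f t = p * f (Suc t) + r * f t + q * of_nat t * f 0"

text \<open>The letters \<open>c\<close> that may follow split into descents, the level and the ascent. All descents
  carry the same weight because each starts a new run with a single letter.\<close>

lemma sum_trun_weight_snoc:
  assumes "catalan_word w"
  shows "(\<Sum>c\<in>{last_run_start w..last w + 1}. trun_weight p q r f (w @ [c])) =
    trun_weight p q r (trun_step p q r f) w"
proof -
  define h l t where "h = last_run_start w" and "l = last w" and "t = nat (l - h)"
  define V where "V = p ^ asc w * q ^ des w * r ^ lev w"
  have w: "w \<noteq> []" and h1: "1 \<le> h" and hl: "h \<le> l"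
    using assms last_run_start_ge_1 last_run_start_le_last
    by (auto simp: h_def l_def catalan_word_def)
  have trun: "trun (w @ [c]) - 1 = (if c < l then 0 else nat (c - h))"
    if "h \<le> c" "c \<le> l + 1" for c
  proof -
    have "catalan_word (w @ [c])"
      using that h1 assms w by (simp add: catalan_word_snoc l_def)
    then show ?thesis
      using trun_eq[of "w @ [c]"] w by (auto simp: last_run_start_snoc h_def l_def)
  qed
  have "trun_weight p q r f (w @ [c]) = q * f 0 * V" if "c \<in> {h..<l}" for c
    using that trun[of c] w
    by (simp add: trun_weight_def asc_snoc des_snoc lev_snoc V_def flip: l_def)
  then have "(\<Sum>c\<in>{h..<l}. trun_weight p q r f (w @ [c])) = of_nat t * (q * f 0 * V)"
    by (simp add: t_def)
  moreover have "trun_weight p q r f (w @ [l]) = r * f t * V"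
    using trun[of l] w hl
    by (simp add: trun_weight_def asc_snoc des_snoc lev_snoc V_def t_def flip: l_def)
  moreover have "trun_weight p q r f (w @ [l + 1]) = p * f (Suc t) * V"
    using trun[of "l + 1"] w hl
    by (simp add: trun_weight_def asc_snoc des_snoc lev_snoc V_def t_def
        nat_add_distrib Suc_nat_eq_nat_zadd1 algebra_simps flip: l_def)
  moreover have "{h..l + 1} = insert (l + 1) (insert l {h..<l})"
    using hl by auto
  moreover have "trun w - 1 = t"
    using trun_eq[OF assms] by (simp add: t_def h_def l_def)
  ultimately show ?thesis
    by (simp add: trun_weight_def[of _ _ _ _ w] trun_step_def V_def algebra_simps
        flip: h_def l_def)
qed

text \<open>Every word of length at least two arises from exactly one shorter word. For \<open>n = 0\<close> this
  fails: the word of length one would come from the empty word, which is not Catalan.\<close>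

lemma sum_flattened_catalan_Suc:
  assumes "n > 0"
  shows "(\<Sum>w\<in>flattened_catalan (Suc n). g w) =
    (\<Sum>w\<in>flattened_catalan n. \<Sum>c\<in>{last_run_start w..last w + 1}. g (w @ [c]))"
proof -
  have ne: "w \<noteq> []" if "w \<in> flattened_catalan m" for w m
    using that by (auto simp: flattened_catalan_def catalan_word_def)
  have split: "w = butlast w @ [last w] \<and> butlast w \<noteq> []" if "w \<in> flattened_catalan (Suc n)" for w
    using that assms by (cases w rule: rev_cases) (auto simp: flattened_catalan_def)
  have "(\<Sum>(w, c)\<in>(SIGMA w:flattened_catalan n. {last_run_start w..last w + 1}). g (w @ [c])) =
      (\<Sum>w\<in>flattened_catalan (Suc n). g w)"
  proof (rule sum.reindex_bij_witness[where j = "\<lambda>(w, c). w @ [c]" and i = "\<lambda>w. (butlast w, last w)"])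
    fix w assume "w \<in> flattened_catalan (Suc n)"
    then show "(butlast w, last w) \<in> (SIGMA w:flattened_catalan n. {last_run_start w..last w + 1})"
      using split[of w] flattened_catalan_snoc[of "butlast w" "last w" n] by auto
  next
    fix a assume "a \<in> (SIGMA w:flattened_catalan n. {last_run_start w..last w + 1})"
    then show "(case a of (w, c) \<Rightarrow> w @ [c]) \<in> flattened_catalan (Suc n)"
      using ne[of "fst a" n] by (auto simp: flattened_catalan_snoc)
  qed (use split in auto)
  then show ?thesis
    by (simp add: sum.Sigma finite_flattened_catalan)
qed

lemma flattened_catalan_0: "flattened_catalan 0 = {}"
  by (auto simp: flattened_catalan_def catalan_word_def)

lemma flattened_catalan_1: "flattened_catalan (Suc 0) = {[1]}"
  by (auto simp: flattened_catalan_def catalan_word_def flattened_def length_Suc_conv)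

text \<open>The term \<open>fps_const (f 0)\<close> accounts for the one-letter word, for which \<open>trun w - 1 = 0\<close>.\<close>

lemma trun_gf_recurrence:
  "trun_gf p q r f = fps_X * (fps_const (f 0) + trun_gf p q r (trun_step p q r f))"
proof (rule fps_ext)
  fix n
  consider "n = 0" | "n = 1" | m where "n = Suc m" "m > 0"
    by (cases n) auto
  then show "fps_nth (trun_gf p q r f) n =
    fps_nth (fps_X * (fps_const (f 0) + trun_gf p q r (trun_step p q r f))) n"
  proof cases
    case 1
    then show ?thesis by (simp add: trun_gf_def flattened_catalan_0)
  next
    case 2
    then show ?thesis
      by (simp add: trun_gf_def flattened_catalan_0 flattened_catalan_1 trun_weight_def
          trun_def asc_def des_def lev_def)
  next
    case (3 m)
    have "(\<Sum>w\<in>flattened_catalan m. \<Sum>c\<in>{last_run_start w..last w + 1}.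
        trun_weight p q r f (w @ [c])) =
        (\<Sum>w\<in>flattened_catalan m. trun_weight p q r (trun_step p q r f) w)"
      by (intro sum.cong refl sum_trun_weight_snoc) (simp add: flattened_catalan_def)
    with 3 show ?thesis
      by (simp add: trun_gf_def sum_flattened_catalan_Suc)
  qed
qed

lemma trun_gf_linear:
  "trun_gf p q r (\<lambda>t. a * f t + b * g t) =
    fps_const a * trun_gf p q r f + fps_const b * trun_gf p q r g"
  by (rule fps_ext)
    (simp add: trun_gf_def trun_weight_def sum.distrib sum_distrib_left algebra_simps)

section \<open>Solving the linear system\<close>

text \<open>The class of functions spanned by \<open>y\<^sup>t\<close>, \<open>1\<close> and \<open>t\<close> is closed under \<open>trun_step\<close>, so the
  recurrence becomes a closed linear system. The elimination is arranged to multiply only,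
  never to divide, and hence works over any commutative ring.\<close>

lemma trun_gf_power:
  fixes p q r y :: "'a::comm_ring_1"
  shows "trun_gf p q r (\<lambda>t. y ^ t) *
      ((1 - fps_const (r + p * y) * fps_X) *
       (1 - fps_const (2 * (p + r)) * fps_X + fps_const ((p + r) ^ 2 - p * q) * fps_X ^ 2)) =
    fps_X * (1 - fps_const (p + r) * fps_X) ^ 2"
proof -
  define A B D where "A = trun_gf p q r (\<lambda>t. y ^ t)"
    and "B = trun_gf p q r (\<lambda>_. 1)" and "D = trun_gf p q r of_nat"
  define X P Q R Y :: "'a fps" where "X = fps_X" and "P = fps_const p" and "Q = fps_const q"
    and "R = fps_const r" and "Y = fps_const y"
  have "trun_step p q r (\<lambda>t. y ^ t) = (\<lambda>t. (r + p * y) * y ^ t + q * of_nat t)"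
    by (simp add: trun_step_def fun_eq_iff algebra_simps)
  with trun_gf_recurrence[of p q r "\<lambda>t. y ^ t"] have A: "A = X * (1 + ((R + P * Y) * A + Q * D))"
    by (simp add: trun_gf_linear A_def D_def X_def P_def Q_def R_def Y_def
        flip: fps_const_add fps_const_mult)
  have "trun_step p q r (\<lambda>_. 1) = (\<lambda>t. (p + r) * 1 + q * of_nat t)"
    by (simp add: trun_step_def fun_eq_iff)
  with trun_gf_recurrence[of p q r "\<lambda>_. 1"] have B: "B = X * (1 + ((P + R) * B + Q * D))"
    using trun_gf_linear[of p q r "p + r" "\<lambda>_. 1" q of_nat]
    by (simp add: B_def D_def X_def P_def Q_def R_def flip: fps_const_add)
  have "trun_step p q r of_nat = (\<lambda>t. (p + r) * of_nat t + p * 1)"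
    by (simp add: trun_step_def fun_eq_iff algebra_simps)
  with trun_gf_recurrence[of p q r of_nat] have D: "D = X * ((P + R) * D + P * B)"
    using trun_gf_linear[of p q r "p + r" of_nat p "\<lambda>_. 1"]
    by (simp add: B_def D_def X_def P_def R_def flip: fps_const_add)
  define S where "S = 1 - (P + R) * X"
  have A': "A * (1 - (R + P * Y) * X) = X + Q * X * D"
    using A by (simp add: algebra_simps)
  have B': "B * S = X + Q * X * D"
    using B by (simp add: S_def algebra_simps)
  have D': "D * S = P * X * B"
    using D by (simp add: S_def algebra_simps)
  \<comment> \<open>Two factors \<open>S\<close> turn \<open>D\<close> first into \<open>B\<close> and then back into \<open>D\<close>.\<close>
  have "D * (S\<^sup>2 - P * Q * X\<^sup>2) = (D * S) * S - P * Q * X\<^sup>2 * D"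
    by (simp add: power2_eq_square algebra_simps)
  also have "\<dots> = P * X * (B * S) - P * Q * X\<^sup>2 * D"
    by (simp add: D' mult.assoc)
  also have "\<dots> = P * X\<^sup>2"
    by (simp add: B' power2_eq_square algebra_simps)
  finally have DQ: "D * (S\<^sup>2 - P * Q * X\<^sup>2) = P * X\<^sup>2" .
  have "A * ((1 - (R + P * Y) * X) * (S\<^sup>2 - P * Q * X\<^sup>2)) =
      X * (S\<^sup>2 - P * Q * X\<^sup>2) + Q * X * (D * (S\<^sup>2 - P * Q * X\<^sup>2))"
    unfolding mult.assoc[symmetric] A' by (simp add: algebra_simps)
  also have "\<dots> = X * S\<^sup>2"
    unfolding DQ by (simp add: power2_eq_square algebra_simps)
  finally have "A * ((1 - (R + P * Y) * X) * (S\<^sup>2 - P * Q * X\<^sup>2)) = X * S\<^sup>2" .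
  moreover have "S\<^sup>2 - P * Q * X\<^sup>2 =
      1 - fps_const (2 * (p + r)) * X + fps_const ((p + r) ^ 2 - p * q) * X\<^sup>2"
    by (simp add: S_def P_def Q_def R_def power2_eq_square algebra_simps mult_2
        flip: fps_const_add fps_const_mult fps_const_sub numeral_fps_const)
  ultimately show ?thesis
    by (simp add: S_def A_def X_def P_def Q_def R_def Y_def)
qed

theorem theorem2p1:
  shows "A_gf =
    fps_quot (fps_X * (1 - fps_const (p_var + r_var) * fps_X) ^ 2)
      ((1 - fps_const (r_var + p_var * y_var) * fps_X) *
       (1 - fps_const (2 * (p_var + r_var)) * fps_X
          + fps_const ((p_var + r_var) ^ 2 - p_var * q_var) * fps_X ^ 2))"
proof -
  have A: "A_gf = trun_gf p_var q_var r_var (\<lambda>t. y_var ^ t)"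
    by (simp add: A_gf_def trun_gf_def trun_weight_def)
  have "fps_nth ((1 - fps_const (r_var + p_var * y_var) * fps_X) *
      (1 - fps_const (2 * (p_var + r_var)) * fps_X
         + fps_const ((p_var + r_var) ^ 2 - p_var * q_var) * fps_X ^ 2)) 0 = 1"
    by simp
  then show ?thesis
    unfolding A by (rule fps_quot_iff[THEN iffD2]) (rule trun_gf_power)
qed

end
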